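(* Let $\mathbb{F}$ be a field, let $n>1$, let $\Omega=\{\omega_1,\dots,\omega_n\}$, and let $(M,\Omega)$ be a finite transformation monoid such that: $I(M)$ contains a constant map; $M\setminus I(M)$ has a unique minimal $\mathscr{J}$-class $J$, and $J$ is regular; and every element of $J$ has rank $2$. Let $P'$ be the matrix over $\mathbb{F}$ (with entries in $\{0,1,-1\}$) associated with $J$ as defined in the context. Then the augmentation submodule $\operatorname{Aug}(\mathbb{F}\Omega)$ is a simple $\mathbb{F}M$-module if and only if the rank of $P'$ over $\mathbb{F}$ is equal to $n-1$.
   Context: A transformation monoid $(M,\Omega)$ is a submonoid $M$ of the monoid $T_\Omega$ of all self-maps of $\Omega$ (acting on the left, containing the identity map). The rank of $m\in M$ is $|m\Omega|$. $I(M)$ is the minimal (two-sided) ideal of $M$. Elements $a,b\in M$ are $\mathscr{J}$-equivalent if $MaM=MbM$; $\mathscr{J}$-classes are ordered by $J_a\le J_b$ iff $MaM\subseteq MbM$. A $\mathscr{J}$-class is regular if it contains an idempotent. $E(J)$ is the set of idempotents in $J$. $\mathbb{F}\Omega$ is the $\mathbb{F}$-vector space with basis $\Omega$, made into a left $\mathbb{F}M$-module by extending the action of $M$ linearly. $\operatorname{Aug}(\mathbb{F}\Omega)$ is the submodule of all linear combinations of elements of $\Omega$ whose coefficients sum to $0$. Assume $J$ consists of maps of rank $2$. Put $N_1=\{e^{-1}(e\omega_1)\mid e\in E(J)\}$, a set of subsets of $\Omega$ (for each idempotent $e \in J$, the block containing $\omega_1$ of its two-block kernel partition), and $N_2=\{(\omega_i,\omega_j)\mid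 i<j \text{ and } e\Omega=\{\omega_i,\omega_j\}\text{ for some } e\in E(J)\}$. The matrix $P'$ has rows indexed by $N_2$ and columns indexed by $N_1$, and for $(\omega_i,\omega_j)\in N_2$, $B\in N_1$ its entry is $0$ if $\omega_i,\omega_j\in B$ or $\omega_i,\omega_j\notin B$; $1$ if $\omega_i\in B$ and $\omega_j\notin B$; $-1$ if $\omega_i\notin B$ and $\omega_j\in B$. (This is obtained from the sandwich matrix $P$ of a Rees matrix semigroup $\mathcal{M}^0(G,N_1,N_2;P)$ isomorphic to $J\cup\{0\}$, whose corresponding entries are $0$, $1_G$ and $g$, where $G=\{1_G,g\}$ or $G$ is trivial, by replacing $1_G$ with $1$ and $g$ with $-1$.) *)

theory Defs
  imports "HOL-Analysis.Analysis"
begin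

text \<open>
  The set \<open>\<Omega>\<close> is the universe of a finite type \<open>'a\<close>; maps act on the left, so the
  product \<open>f g\<close> is \<open>f \<circ> g\<close>.
\<close>

definition transformation_monoid :: "('a \<Rightarrow> 'a) set \<Rightarrow> bool" where
  "transformation_monoid M \<longleftrightarrow> id \<in> M \<and> (\<forall>f\<in>M. \<forall>g\<in>M. f \<circ> g \<in> M)"

definition map_rank :: "('a \<Rightarrow> 'a) \<Rightarrow> nat" where
  "map_rank f = card (range f)"

definition two_sided_ideal :: "('a \<Rightarrow> 'a) set \<Rightarrow> ('a \<Rightarrow> 'a) set \<Rightarrow> bool" where
  "two_sided_ideal M I \<longleftrightarrow>
     I \<noteq> {} \<and> I \<subseteq> M \<and> (\<forall>m\<in>M. \<forall>x\<in>I. m \<circ> x \<in> I \<and> x \<circ> m \<in> I)"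

text \<open>A finite monoid has exactly one minimal ideal, so the description below is proper.\<close>

definition minimal_ideal :: "('a \<Rightarrow> 'a) set \<Rightarrow> ('a \<Rightarrow> 'a) set" where
  "minimal_ideal M =
     (THE I. two_sided_ideal M I \<and> (\<forall>K. two_sided_ideal M K \<and> K \<subseteq> I \<longrightarrow> K = I))"

definition principal_ideal :: "('a \<Rightarrow> 'a) set \<Rightarrow> ('a \<Rightarrow> 'a) \<Rightarrow> ('a \<Rightarrow> 'a) set" where
  "principal_ideal M a = {x \<circ> a \<circ> y | x y. x \<in> M \<and> y \<in> M}"

definition J_class :: "('a \<Rightarrow> 'a) set \<Rightarrow> ('a \<Rightarrow> 'a) \<Rightarrow> ('a \<Rightarrow> 'a) set" where
  "J_class M a = {b \<in> M. principal_ideal M a = principal_ideal M b}"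

definition J_classes :: "('a \<Rightarrow> 'a) set \<Rightarrow> ('a \<Rightarrow> 'a) set set" where
  "J_classes M = J_class M ` M"

definition J_class_le :: "('a \<Rightarrow> 'a) set \<Rightarrow> ('a \<Rightarrow> 'a) set \<Rightarrow> ('a \<Rightarrow> 'a) set \<Rightarrow> bool" where
  "J_class_le M J K \<longleftrightarrow> (\<forall>a\<in>J. \<forall>b\<in>K. principal_ideal M a \<subseteq> principal_ideal M b)"

definition minimal_J_class_in ::
    "('a \<Rightarrow> 'a) set \<Rightarrow> ('a \<Rightarrow> 'a) set \<Rightarrow> ('a \<Rightarrow> 'a) set \<Rightarrow> bool" where
  "minimal_J_class_in M S J \<longleftrightarrow> J \<in> J_classes M \<and> J \<subseteq> S \<and>
     (\<forall>K\<in>J_classes M. K \<subseteq> S \<and> J_class_le M K J \<longrightarrow> K = J)"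

definition unique_minimal_J_class_in ::
    "('a \<Rightarrow> 'a) set \<Rightarrow> ('a \<Rightarrow> 'a) set \<Rightarrow> ('a \<Rightarrow> 'a) set \<Rightarrow> bool" where
  "unique_minimal_J_class_in M S J \<longleftrightarrow> (\<forall>K. minimal_J_class_in M S K \<longleftrightarrow> K = J)"

definition idempotents :: "('a \<Rightarrow> 'a) set \<Rightarrow> ('a \<Rightarrow> 'a) set" where
  "idempotents J = {e \<in> J. e \<circ> e = e}"

definition regular_J_class :: "('a \<Rightarrow> 'a) set \<Rightarrow> bool" where
  "regular_J_class J \<longleftrightarrow> idempotents J \<noteq> {}"

text \<open>
  The space with basis \<open>\<Omega>\<close> over the field \<open>'k\<close> is \<^typ>\<open>'k ^ 'a\<close>, the basis vector of \<open>x\<close>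
  being \<open>axis x 1\<close>.  An element of the monoid algebra is a coefficient function
  \<open>c\<close> on \<open>M\<close>; its values outside \<open>M\<close> are ignored.
\<close>

definition map_action :: "('a \<Rightarrow> 'a) \<Rightarrow> 'k::field ^ 'a::finite \<Rightarrow> 'k ^ 'a" where
  "map_action m v = (\<Sum>x\<in>UNIV. v $ x *s axis (m x) 1)"

definition monoid_algebra_action ::
    "('a \<Rightarrow> 'a) set \<Rightarrow> (('a \<Rightarrow> 'a) \<Rightarrow> 'k::field) \<Rightarrow> 'k ^ 'a::finite \<Rightarrow> 'k ^ 'a" where
  "monoid_algebra_action M c v = (\<Sum>m\<in>M. c m *s map_action m v)"

definition FM_submodule :: "('a \<Rightarrow> 'a) set \<Rightarrow> ('k::field ^ 'a::finite) set \<Rightarrow> bool" where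
  "FM_submodule M W \<longleftrightarrow> 0 \<in> W \<and> (\<forall>u\<in>W. \<forall>v\<in>W. u + v \<in> W) \<and>
     (\<forall>c. \<forall>v\<in>W. monoid_algebra_action M c v \<in> W)"

definition simple_FM_module :: "('a \<Rightarrow> 'a) set \<Rightarrow> ('k::field ^ 'a::finite) set \<Rightarrow> bool" where
  "simple_FM_module M W \<longleftrightarrow> FM_submodule M W \<and> W \<noteq> {0} \<and>
     (\<forall>U. FM_submodule M U \<and> U \<subseteq> W \<longrightarrow> U = {0} \<or> U = W)"

definition Aug :: "('k::field ^ 'a::finite) set" where
  "Aug = {v. (\<Sum>x\<in>UNIV. v $ x) = 0}"

definition N1 :: "(nat \<Rightarrow> 'a) \<Rightarrow> ('a \<Rightarrow> 'a) set \<Rightarrow> 'a set set" where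
  "N1 \<omega> J = {e -` {e (\<omega> 1)} | e. e \<in> idempotents J}"

definition N2 :: "nat \<Rightarrow> (nat \<Rightarrow> 'a) \<Rightarrow> ('a \<Rightarrow> 'a) set \<Rightarrow> ('a \<times> 'a) set" where
  "N2 n \<omega> J = {(\<omega> i, \<omega> j) | i j. i \<in> {1..n} \<and> j \<in> {1..n} \<and> i < j \<and>
     (\<exists>e\<in>idempotents J. range e = {\<omega> i, \<omega> j})}"

definition P'_entry :: "'a \<times> 'a \<Rightarrow> 'a set \<Rightarrow> 'k::field" where
  "P'_entry p B =
     (if fst p \<in> B \<and> snd p \<notin> B then 1
      else if fst p \<notin> B \<and> snd p \<in> B then - 1
      else 0)"

text \<open>
  Library matrices are indexed by whole types (in \<^typ>\<open>'k ^ 'c ^ 'r\<close> the rows are indexed by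
  \<open>'r\<close>).  The matrix with rows \<open>N2\<close> and columns \<open>N1\<close> is therefore bordered by zero rows and
  zero columns for the remaining pairs and subsets, which does not affect its rank.
\<close>

definition P' :: "nat \<Rightarrow> (nat \<Rightarrow> 'a) \<Rightarrow> ('a \<Rightarrow> 'a) set \<Rightarrow>
    'k::field ^ ('a::finite set) ^ ('a \<times> 'a)" where
  "P' n \<omega> J = (\<chi> p B. if p \<in> N2 n \<omega> J \<and> B \<in> N1 \<omega> J then P'_entry p B else 0)"

end

theory Submission
  imports Defs
begin

text \<open>
  A map \<open>f \<in> J\<close> with image \<open>{a, b}\<close> acts on the augmentation module by
  \<open>v \<mapsto> (sum of v over f\<^sup>-\<^sup>1(a)) (a - b)\<close>, and a nonconstant \<open>m \<in> M\<close> has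
  \<open>J \<subseteq> M m M\<close>.  Hence the differences \<open>a - b\<close> over the images of \<open>J\<close> span a nonzero submodule
  contained in every submodule that \<open>J\<close> does not annihilate, so simplicity means that this span
  is everything and that no nonzero vector is annihilated by \<open>J\<close>.  By regularity, images and
  kernels of idempotents suffice, so \<open>P'\<close> is the matrix of the pairing between the differences
  and the block sums; it has rank \<open>n - 1\<close> exactly when the differences span the augmentation
  module and the block sums separate its points.
\<close>

section \<open>Minimal ideal and minimal \<open>J\<close>-class\<close>

text \<open>Existence comes from finiteness. If L and L' are both minimal, the product of an element
  of L with one of L' lies in both, so their intersection is an ideal and equals each of them. This
  licenses the \<open>THE\<close> in \<open>minimal_ideal\<close>.\<close>

lemma minimal_ideal_properties:
  fixes M :: "('a::finite \<Rightarrow> 'a) set"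
  assumes "transformation_monoid M"
  shows "two_sided_ideal M (minimal_ideal M)"
    and "two_sided_ideal M K \<Longrightarrow> K \<subseteq> minimal_ideal M \<Longrightarrow> K = minimal_ideal M"
proof -
  let ?P = "\<lambda>I. two_sided_ideal M I \<and> (\<forall>K. two_sided_ideal M K \<and> K \<subseteq> I \<longrightarrow> K = I)"
  have "two_sided_ideal M M"
    using assms by (auto simp: two_sided_ideal_def transformation_monoid_def)
  then obtain I where I: "two_sided_ideal M I"
      "\<And>K. two_sided_ideal M K \<Longrightarrow> K \<subseteq> I \<Longrightarrow> K = I"
    using finite_has_minimal[of "{I. two_sided_ideal M I}"] by auto
  have uniq: "L = L'" if L: "?P L" and L': "?P L'" for L L'
  proof -
    have ideals: "two_sided_ideal M L" "two_sided_ideal M L'" using L L' by simp_all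
    then obtain x y where x: "x \<in> L" "x \<in> M" and y: "y \<in> L'" "y \<in> M"
      unfolding two_sided_ideal_def by blast
    then have "x \<circ> y \<in> L \<inter> L'"
      using ideals unfolding two_sided_ideal_def by simp
    then have "two_sided_ideal M (L \<inter> L')"
      using ideals unfolding two_sided_ideal_def by auto
    then show ?thesis using L L' by (metis inf_le1 inf_le2)
  qed
  have "?P (minimal_ideal M)"
    unfolding minimal_ideal_def
    by (rule theI[where P = ?P, OF _ uniq]) (use I in blast)+
  then show "two_sided_ideal M (minimal_ideal M)"
    and "two_sided_ideal M K \<Longrightarrow> K \<subseteq> minimal_ideal M \<Longrightarrow> K = minimal_ideal M"
    by blast+
qed

text \<open>Composing a constant map with any map on either side gives a constant, so the constants
  inside the minimal ideal already form an ideal and minimality applies. Conversely, a constant y in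
  M equals (constant y) o (constant x), where x is the given one.\<close>

lemma minimal_ideal_eq_constants:
  fixes M :: "('a::finite \<Rightarrow> 'a) set"
  assumes mon: "transformation_monoid M"
    and const: "\<exists>m\<in>minimal_ideal M. \<exists>x. m = (\<lambda>_. x)"
  shows "minimal_ideal M = {m \<in> M. \<exists>x. m = (\<lambda>_. x)}"
proof -
  let ?I = "minimal_ideal M"
  obtain x where x: "(\<lambda>_. x) \<in> ?I" using const by blast
  have I: "two_sided_ideal M ?I" using minimal_ideal_properties(1)[OF mon] .
  have "two_sided_ideal M (?I \<inter> {m. \<exists>x. m = (\<lambda>_. x)})"
    using I x unfolding two_sided_ideal_def by (auto simp: comp_def)
  then have "?I \<inter> {m. \<exists>x. m = (\<lambda>_. x)} = ?I"
    by (rule minimal_ideal_properties(2)[OF mon]) simp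
  moreover have "(\<lambda>_. y) \<in> ?I" if "(\<lambda>_. y) \<in> M" for y
  proof -
    have "(\<lambda>_. y) \<circ> (\<lambda>_. x) \<in> ?I"
      using I x that unfolding two_sided_ideal_def by blast
    then show ?thesis by (simp add: comp_def)
  qed
  ultimately show ?thesis
    using I unfolding two_sided_ideal_def by blast
qed

lemma principal_ideal_self:
  "transformation_monoid M \<Longrightarrow> a \<in> principal_ideal M a"
  unfolding transformation_monoid_def principal_ideal_def
  by (metis (mono_tags, lifting) comp_id id_comp mem_Collect_eq)

lemma principal_ideal_subset:
  assumes "transformation_monoid M" "b \<in> principal_ideal M a"
  shows "principal_ideal M b \<subseteq> principal_ideal M a"
proof
  fix z assume "z \<in> principal_ideal M b"
  then obtain x y x' y' where "z = x \<circ> (x' \<circ> a \<circ> y') \<circ> y" "x \<in> M" "y \<in> M" "x' \<in> M" "y' \<in> M"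
    using assms(2) unfolding principal_ideal_def by auto
  then have "z = (x \<circ> x') \<circ> a \<circ> (y' \<circ> y)" "x \<circ> x' \<in> M" "y' \<circ> y \<in> M"
    using assms(1) by (auto simp: comp_assoc transformation_monoid_def)
  then show "z \<in> principal_ideal M a" unfolding principal_ideal_def by blast
qed

text \<open>By finiteness, some \<J>-class below m is minimal in M - I; uniqueness identifies it
  with J.\<close>

lemma unique_minimal_J_class_below:
  fixes M :: "('a::finite \<Rightarrow> 'a) set"
  assumes mon: "transformation_monoid M" and I: "two_sided_ideal M I"
    and J: "unique_minimal_J_class_in M (M - I) J"
    and m: "m \<in> M - I" and f: "f \<in> J"
  shows "f \<in> principal_ideal M m"
proof -
  let ?S = "{a \<in> M - I. a \<in> principal_ideal M m}"
  have "m \<in> ?S" using m principal_ideal_self[OF mon] by blast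
  then have "?S \<noteq> {}" by blast
  \<comment> \<open>Minimising the size of the ideal suffices: an inclusion of finite ideals that
    does not drop in size is an equality, hence \<J>-equivalence.\<close>
  define a where "a = arg_min_on (\<lambda>b. card (principal_ideal M b)) ?S"
  have a: "a \<in> ?S"
    unfolding a_def by (rule arg_min_if_finite(1)[OF finite \<open>?S \<noteq> {}\<close>])
  have min: "card (principal_ideal M a) \<le> card (principal_ideal M b)" if "b \<in> ?S" for b
    unfolding a_def by (rule arg_min_least[OF finite \<open>?S \<noteq> {}\<close> that])
  have "minimal_J_class_in M (M - I) (J_class M a)"
    unfolding minimal_J_class_in_def
  proof (intro conjI ballI impI)
    show "J_class M a \<in> J_classes M" using a by (auto simp: J_classes_def)
    show "J_class M a \<subseteq> M - I"
    proof
      fix b assume b: "b \<in> J_class M a"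
      then have "a \<in> principal_ideal M b"
        using principal_ideal_self[OF mon, of a] by (auto simp: J_class_def)
      then obtain x y where "a = x \<circ> b \<circ> y" "x \<in> M" "y \<in> M"
        by (auto simp: principal_ideal_def)
      then have "b \<in> I \<Longrightarrow> a \<in> I" using I by (simp add: two_sided_ideal_def)
      then show "b \<in> M - I" using a b by (auto simp: J_class_def)
    qed
    fix K assume K: "K \<in> J_classes M" "K \<subseteq> M - I \<and> J_class_le M K (J_class M a)"
    then obtain c where c: "c \<in> M" "K = J_class M c" by (auto simp: J_classes_def)
    have "c \<in> K" "a \<in> J_class M a" using c a by (auto simp: J_class_def)
    then have le: "principal_ideal M c \<subseteq> principal_ideal M a" and "c \<in> M - I"
      using K by (auto simp: J_class_le_def)
    moreover have "c \<in> principal_ideal M m"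
      using le principal_ideal_self[OF mon, of c] principal_ideal_subset[OF mon, of a m] a by blast
    ultimately have "card (principal_ideal M a) \<le> card (principal_ideal M c)"
      using min by blast
    then have "principal_ideal M c = principal_ideal M a"
      using le by (metis card_seteq finite)
    then show "K = J_class M a" using c by (simp add: J_class_def)
  qed
  then have "J_class M a = J" using J by (simp add: unique_minimal_J_class_in_def)
  then have "f \<in> principal_ideal M a"
    using f principal_ideal_self[OF mon, of f] by (auto simp: J_class_def)
  then show ?thesis using a principal_ideal_subset[OF mon, of a m] by blast
qed

section \<open>The permutation module\<close>

lemma map_action_nth: "map_action m v $ y = (\<Sum>x\<in>m -` {y}. v $ x)"
proof -
  have "map_action m v $ y = (\<Sum>x\<in>UNIV. if m x = y then v $ x else 0)"
    by (auto simp: map_action_def axis_def intro!: sum.cong)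
  also have "\<dots> = (\<Sum>x\<in>m -` {y}. v $ x)"
    by (rule sum.mono_neutral_cong_right) auto
  finally show ?thesis .
qed

lemma map_action_axis: "map_action m (axis x 1 :: 'k::field ^ 'a::finite) = axis (m x) 1"
  by (auto simp: vec_eq_iff map_action_nth axis_def)

lemma linear_map_action:
  "Vector_Spaces.linear (*s) (*s) (map_action m :: 'k::field ^ 'a::finite \<Rightarrow> _)"
  by unfold_locales
    (auto simp: vec_eq_iff map_action_nth sum.distrib sum_distrib_left algebra_simps)

interpretation map_action: Vector_Spaces.linear "(*s)" "(*s)" "map_action m :: 'k::field ^ 'a::finite \<Rightarrow> _"
  by (rule linear_map_action)

lemma map_action_comp: "map_action (f \<circ> g) v = map_action f (map_action g v)"
  unfolding map_action_def[of g] map_action_def[of "f \<circ> g"]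
  by (simp add: map_action.sum map_action.scale map_action_axis)

text \<open>A coefficient function supported at the single element m acts as a multiple of m; the
  case m = \<open>id\<close> yields closure under scalars. Conversely the monoid algebra acts by
  linear combinations of elements of M.\<close>

lemma FM_submodule_iff:
  fixes M :: "('a::finite \<Rightarrow> 'a) set" and W :: "('k::field ^ 'a) set"
  assumes "transformation_monoid M"
  shows "FM_submodule M W \<longleftrightarrow> vec.subspace W \<and> (\<forall>m\<in>M. \<forall>v\<in>W. map_action m v \<in> W)"
proof
  assume W: "FM_submodule M W"
  have single: "c *s map_action m v \<in> W" if "m \<in> M" "v \<in> W" for c m v
  proof -
    have "monoid_algebra_action M (\<lambda>x. if x = m then c else 0) v
        = (\<Sum>x\<in>M. if x = m then c *s map_action m v else 0)"
      unfolding monoid_algebra_action_def by (rule sum.cong) auto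
    then have "monoid_algebra_action M (\<lambda>x. if x = m then c else 0) v = c *s map_action m v"
      using that by simp
    then show ?thesis using W that unfolding FM_submodule_def by metis
  qed
  have "map_action id v = v" for v :: "'k ^ 'a" by (simp add: vec_eq_iff map_action_nth)
  then have "c *s v \<in> W" if "v \<in> W" for c v
    using single[of id v c] that assms by (simp add: transformation_monoid_def)
  moreover have "map_action m v \<in> W" if "m \<in> M" "v \<in> W" for m v
    using single[of m v 1] that by simp
  ultimately show "vec.subspace W \<and> (\<forall>m\<in>M. \<forall>v\<in>W. map_action m v \<in> W)"
    using W by (auto simp: FM_submodule_def vec.subspace_def)
next
  assume W: "vec.subspace W \<and> (\<forall>m\<in>M. \<forall>v\<in>W. map_action m v \<in> W)"
  then show "FM_submodule M W"
    unfolding FM_submodule_def monoid_algebra_action_def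
    by (auto simp: vec.subspace_0 vec.subspace_add intro!: vec.subspace_sum vec.subspace_scale)
qed

abbreviation diff_vec :: "'a \<Rightarrow> 'a \<Rightarrow> 'k::field ^ 'a::finite" where
  "diff_vec a b \<equiv> axis a 1 - axis b 1"

lemma diff_vec_in_Aug: "diff_vec a b \<in> Aug"
  by (simp add: Aug_def sum_subtractf axis_def)

lemma diff_vec_nonzero: "a \<noteq> b \<Longrightarrow> diff_vec a b \<noteq> (0 :: 'k::field ^ 'a::finite)"
  by (auto simp: axis_eq_axis)

lemma map_action_diff_vec: "map_action m (diff_vec a b) = diff_vec (m a) (m b)"
  by (simp add: map_action.diff map_action_axis)

lemma subspace_Aug: "vec.subspace (Aug :: ('k::field ^ 'a::finite) set)"
  by (auto simp: vec.subspace_def Aug_def sum.distrib simp flip: sum_distrib_left)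

lemma map_action_in_Aug:
  assumes "v \<in> Aug" shows "map_action m v \<in> Aug"
proof -
  have "(\<Sum>y\<in>UNIV. map_action m v $ y) = (\<Sum>y\<in>UNIV. \<Sum>x\<in>{x \<in> UNIV. m x = y}. v $ x)"
    by (simp add: map_action_nth vimage_def)
  also have "\<dots> = (\<Sum>x\<in>UNIV. v $ x)" by (rule sum.group) auto
  finally show ?thesis using assms by (simp add: Aug_def)
qed

lemma map_action_constant:
  assumes "v \<in> Aug" shows "map_action (\<lambda>_. x) v = 0"
  using assms by (auto simp: vec_eq_iff map_action_nth Aug_def vimage_def)

text \<open>The two fibres of f partition the universe, so for an augmentation vector the two fibre
  sums are negatives of each other.\<close>

lemma map_action_rank_two:
  assumes "v \<in> Aug" "range f = {a, b}" "a \<noteq> b"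
  shows "map_action f v = (\<Sum>x\<in>f -` {a}. v $ x) *s diff_vec a b"
proof -
  have disj: "f -` {a} \<inter> f -` {b} = {}" and un: "f -` {a} \<union> f -` {b} = UNIV"
    using assms by auto
  have "(\<Sum>x\<in>f -` {a}. v $ x) + (\<Sum>x\<in>f -` {b}. v $ x) = 0"
    using sum.union_disjoint[OF _ _ disj, of "($) v"] un assms(1) by (simp add: Aug_def)
  then have "(\<Sum>x\<in>f -` {b}. v $ x) = - (\<Sum>x\<in>f -` {a}. v $ x)"
    by (simp add: eq_neg_iff_add_eq_0 add.commute)
  moreover have "f -` {y} = {}" if "y \<noteq> a" "y \<noteq> b" for y
    using assms(2) that by blast
  ultimately show ?thesis
    using assms(3) by (auto simp: vec_eq_iff map_action_nth axis_def)
qed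

lemma dim_Aug: "vec.dim (Aug :: ('k::field ^ 'a::finite) set) = CARD('a) - 1"
proof -
  let ?A = "Aug :: ('k ^ 'a) set"
  \<comment> \<open>Any point serves: subtracting the coefficient sum times its basis vector moves a
    vector into \<open>Aug\<close>, so one extra generator completes \<open>Aug\<close> to the whole
    space.\<close>
  obtain z :: 'a where True by blast
  let ?z = "axis z 1 :: 'k ^ 'a"
  have "v \<in> vec.span (insert ?z ?A)" for v :: "'k ^ 'a"
  proof -
    let ?c = "\<Sum>x\<in>UNIV. v $ x"
    have "v - ?c *s ?z \<in> Aug"
      by (simp add: Aug_def sum_subtractf axis_def if_distrib[of "\<lambda>x. _ * x"] cong: if_cong)
    then show ?thesis
      unfolding vec.span_insert by (auto intro: vec.span_base)
  qed
  then have "vec.span (insert ?z ?A) = UNIV" by blast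
  then have "vec.dim (insert ?z ?A) = CARD('a)"
    by (metis vec.dim_span vec_dim_card)
  moreover have "?z \<notin> vec.span ?A"
    by (simp add: vec.span_eq_iff[THEN iffD2] subspace_Aug) (simp add: Aug_def axis_def)
  ultimately show ?thesis by (simp add: vec.dim_insert)
qed

text \<open>A nonzero kernel vector extends to a basis of W; the images of the other basis vectors
  alone span the image of W, so the dimension would drop.\<close>

lemma linear_inj_on_if_dim_image_eq:
  fixes T :: "'k::field ^ 'a::finite \<Rightarrow> 'k ^ 'b::finite"
  assumes T: "Vector_Spaces.linear (*s) (*s) T" and W: "vec.subspace W"
    and dim: "vec.dim (T ` W) = vec.dim W" and v: "v \<in> W" "T v = 0"
  shows "v = 0"
proof (rule ccontr)
  interpret T: Vector_Spaces.linear "(*s)" "(*s)" T by (rule T)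
  assume "v \<noteq> 0"
  then have "vec.independent {v}" by simp
  then obtain B where B: "{v} \<subseteq> B" "B \<subseteq> W" "vec.independent B" "W \<subseteq> vec.span B"
    using vec.maximal_independent_subset_extend[of "{v}" W] v(1) by auto
  have fin: "finite B" using B(3) by (rule vec.finiteI_independent)
  have "T ` W \<subseteq> vec.span (T ` B)" using B(4) by (metis T.span_image image_mono)
  also have "T ` B = insert 0 (T ` (B - {v}))" using B(1) v(2) by auto
  finally have "T ` W \<subseteq> vec.span (T ` (B - {v}))" by simp
  then have "vec.dim (T ` W) \<le> card (T ` (B - {v}))"
    using fin by (intro vec.dim_le_card) auto
  also have "\<dots> \<le> card (B - {v})" using fin by (intro card_image_le) auto
  also have "\<dots> < card B" using B(1) fin by (intro psubset_card_mono) auto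
  also have "card B = vec.dim W"
    using vec.basis_card_eq_dim[OF B(2,4,3)] by simp
  finally show False using dim by simp
qed

text \<open>In dim T(V) \<le> dim V \<le> dim W, equality of the ends forces both equalities. It is
  applied with V = \<open>diff_span\<close>, W = \<open>Aug\<close> and T =
  \<open>block_sums\<close>, which splits the rank condition into the two halves of the simplicity
  criterion.\<close>

lemma dim_linear_image_eq_iff:
  fixes T :: "'k::field ^ 'a::finite \<Rightarrow> 'k ^ 'b::finite"
  assumes T: "Vector_Spaces.linear (*s) (*s) T"
    and W: "vec.subspace W" and V: "vec.subspace V" "V \<subseteq> W"
  shows "vec.dim (T ` V) = vec.dim W \<longleftrightarrow> V = W \<and> (\<forall>v\<in>W. T v = 0 \<longrightarrow> v = 0)"
proof
  assume dim: "vec.dim (T ` V) = vec.dim W"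
  then have "vec.dim W \<le> vec.dim V" by (metis T vec.dim_image_le)
  then have "V = W" using vec.subspace_dim_equal[OF V(1) W V(2)] by simp
  then show "V = W \<and> (\<forall>v\<in>W. T v = 0 \<longrightarrow> v = 0)"
    using linear_inj_on_if_dim_image_eq[OF T W] dim by blast
next
  assume A: "V = W \<and> (\<forall>v\<in>W. T v = 0 \<longrightarrow> v = 0)"
  then have "inj_on T (vec.span W)"
    using vec.linear_inj_on_iff_eq_0[OF T W] W by (metis vec.span_eq_iff)
  then show "vec.dim (T ` V) = vec.dim W" using A vec.dim_image_eq[OF T] by metis
qed

section \<open>The regular \<open>J\<close>-class of maps of rank two\<close>

text \<open>\<open>J_below\<close> and \<open>J_absorbs\<close> extract what is needed from the
  \<J>-order: modulo constants, J behaves like a 0-simple semigroup whose zero is the class of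
  constant maps.\<close>

locale rank_two_class =
  fixes M J :: "('a::finite \<Rightarrow> 'a) set"
  assumes monoid: "transformation_monoid M"
    and J_subset: "J \<subseteq> M"
    and rank_two: "f \<in> J \<Longrightarrow> card (range f) = 2"
    and J_below: "m \<in> M \<Longrightarrow> \<forall>x. m \<noteq> (\<lambda>_. x) \<Longrightarrow> f \<in> J \<Longrightarrow> \<exists>x\<in>M. \<exists>y\<in>M. f = x \<circ> m \<circ> y"
    and J_absorbs: "f \<in> J \<Longrightarrow> x \<in> M \<Longrightarrow> y \<in> M \<Longrightarrow> \<forall>z. x \<circ> f \<circ> y \<noteq> (\<lambda>_. z) \<Longrightarrow> x \<circ> f \<circ> y \<in> J"
    and regular: "idempotents J \<noteq> {}"
begin

lemma id_in: "id \<in> M" and comp_in: "f \<in> M \<Longrightarrow> g \<in> M \<Longrightarrow> f \<circ> g \<in> M"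
  using monoid by (auto simp: transformation_monoid_def)

lemma nonconstant: "f \<in> J \<Longrightarrow> f \<noteq> (\<lambda>_. z)"
  using rank_two by fastforce

lemma range_J:
  assumes "f \<in> J" obtains a b where "range f = {a, b}" "a \<noteq> b"
  using rank_two[OF assms] by (auto simp: card_2_iff)

lemma ex_J_factor:
  assumes "f \<in> J" "h \<in> J"
  shows "\<exists>x\<in>M. \<exists>y\<in>M. h = x \<circ> f \<circ> y"
  using J_below[of f h] assms J_subset nonconstant by blast

text \<open>If \<open>e = u f v\<close> is idempotent of rank two, then \<open>f v u\<close> is an idempotent with the image
  of \<open>f\<close> and \<open>v u f\<close> is an idempotent with the kernel of \<open>f\<close>.\<close>

lemma ex_idempotent_same_range:
  assumes f: "f \<in> J"
  shows "\<exists>g\<in>idempotents J. range g = range f"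
proof -
  obtain e where e: "e \<in> J" "e \<circ> e = e" using regular by (auto simp: idempotents_def)
  then obtain u v where uv: "u \<in> M" "v \<in> M" "e = u \<circ> f \<circ> v" using ex_J_factor[OF f] by blast
  \<comment> \<open>Since e has rank 2, u cannot collapse the two-point image of f; this injectivity
    allows u to be cancelled.\<close>
  have "range e \<subseteq> u ` range f" using uv(3) by auto
  then have "card (u ` range f) \<ge> 2" by (metis card_mono finite rank_two[OF e(1)])
  then have "card (u ` range f) = card (range f)"
    using card_image_le[of "range f" u] rank_two[OF f] by simp
  then have inj: "inj_on u (range f)" by (simp add: eq_card_imp_inj_on)
  have e2: "e (e z) = e z" for z using e(2) by (metis comp_apply)
  then have "u (f (v (e z))) = u (f (v z))" for z using uv(3) by simp
  then have "f (v (e z)) = f (v z)" for z by (rule inj_onD[OF inj]) auto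
  then have idem: "(f \<circ> (v \<circ> u)) \<circ> (f \<circ> (v \<circ> u)) = f \<circ> (v \<circ> u)"
    using uv(3) by (auto simp: fun_eq_iff)
  have nc: "f \<circ> (v \<circ> u) \<noteq> (\<lambda>_. z)" for z
  proof
    assume "f \<circ> (v \<circ> u) = (\<lambda>_. z)"
    then have "f (v (u x)) = z" for x by (metis comp_apply)
    then have "e (e x) = u z" for x using uv(3) by simp
    then show False using nonconstant[OF e(1), of "u z"] e2 by auto
  qed
  have J: "f \<circ> (v \<circ> u) \<in> J"
    using nc J_absorbs[OF f id_in comp_in[OF uv(2,1)]] by simp
  have "range (f \<circ> (v \<circ> u)) = range f"
    by (rule card_subset_eq) (auto simp only: rank_two[OF f] rank_two[OF J], auto)
  then show ?thesis using J idem by (auto simp: idempotents_def)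
qed

lemma ex_idempotent_same_kernel:
  assumes f: "f \<in> J"
  shows "\<exists>g\<in>idempotents J. \<forall>a b. g a = g b \<longleftrightarrow> f a = f b"
proof -
  obtain e where e: "e \<in> J" "e \<circ> e = e" using regular by (auto simp: idempotents_def)
  then obtain u v where uv: "u \<in> M" "v \<in> M" "e = u \<circ> f \<circ> v" using ex_J_factor[OF f] by blast
  \<comment> \<open>By counting, u carries the image of f onto the image of e, which e fixes
    pointwise.\<close>
  have "card (u ` range f) \<le> 2" using card_image_le[of "range f" u] rank_two[OF f] by simp
  moreover have "range e \<subseteq> u ` range f" using uv(3) by auto
  ultimately have "range e = u ` range f"
    using rank_two[OF e(1)] by (metis card_seteq finite)
  moreover have e2: "e (e z) = e z" for z using e(2) by (metis comp_apply)
  ultimately have "e w = w" if "w \<in> u ` range f" for w using that by (metis imageE)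
  then have "e (u (f z)) = u (f z)" for z by blast
  then have idem: "((v \<circ> u) \<circ> f) \<circ> ((v \<circ> u) \<circ> f) = (v \<circ> u) \<circ> f"
    using uv(3) by (auto simp: fun_eq_iff)
  have nc: "(v \<circ> u) \<circ> f \<noteq> (\<lambda>_. z)" for z
  proof
    assume "(v \<circ> u) \<circ> f = (\<lambda>_. z)"
    then have "v (u (f x)) = z" for x by (metis comp_apply)
    then have "e (e x) = u (f z)" for x using uv(3) by simp
    then show False using nonconstant[OF e(1), of "u (f z)"] e2 by auto
  qed
  have J: "(v \<circ> u) \<circ> f \<in> J"
    using nc J_absorbs[OF f comp_in[OF uv(2,1)] id_in] by simp
  \<comment> \<open>The kernel of v u f contains that of f. Were it larger, both values of f would
    be identified and v u f would be constant.\<close>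
  have "f a = f b" if "v (u (f a)) = v (u (f b))" for a b
  proof (rule ccontr)
    assume "f a \<noteq> f b"
    then have "range f = {f a, f b}"
      using rank_two[OF f] by (intro card_subset_eq[symmetric]) auto
    then have "f z = f a \<or> f z = f b" for z by blast
    then have "(v \<circ> u) \<circ> f = (\<lambda>_. v (u (f a)))"
      using that by (metis comp_apply ext)
    then show False using nc by blast
  qed
  then show ?thesis using J idem by (intro bexI[of _ "(v \<circ> u) \<circ> f"]) (auto simp: idempotents_def)
qed

section \<open>Two submodules of the augmentation module and the simplicity criterion\<close>

text \<open>By \<open>map_action_rank_two\<close>, this is the span of all
  \<open>map_action f v\<close> with f in J and v in \<open>Aug\<close>.\<close>

definition diff_span :: "('k::field ^ 'a) set" where
  "diff_span = vec.span {diff_vec a b | a b. \<exists>f\<in>J. range f = {a, b}}"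

lemma diff_span_subset_Aug: "diff_span \<subseteq> Aug"
  unfolding diff_span_def
  by (rule vec.span_minimal) (auto simp: diff_vec_in_Aug subspace_Aug)

text \<open>A generator a - b coming from f is sent to m a - m b, which is either zero or the
  generator coming from m o f, a nonconstant map and hence again in J.\<close>

lemma FM_submodule_diff_span: "FM_submodule M (diff_span :: ('k::field ^ 'a) set)"
  unfolding FM_submodule_iff[OF monoid]
proof (intro conjI ballI)
  let ?G = "{diff_vec a b :: 'k ^ 'a | a b. \<exists>f\<in>J. range f = {a, b}}"
  show "vec.subspace (diff_span :: ('k ^ 'a) set)" by (simp add: diff_span_def)
  fix m and v :: "'k ^ 'a"
  assume m: "m \<in> M" and v: "v \<in> diff_span"
  have "map_action m ` ?G \<subseteq> vec.span ?G"
  proof clarify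
    fix a b f assume f: "f \<in> J" "range f = {a, b}"
    show "map_action m (diff_vec a b) \<in> vec.span ?G"
    proof (cases "m a = m b")
      case True
      then show ?thesis by (simp add: map_action_diff_vec vec.span_zero)
    next
      case False
      have rg: "range (m \<circ> f) = {m a, m b}" using f(2) by (simp only: image_comp [symmetric]) simp
      have "m \<circ> f \<noteq> (\<lambda>_. z)" for z
      proof
        assume "m \<circ> f = (\<lambda>_. z)"
        then have "range (m \<circ> f) = {z}" by auto
        then show False using rg False by auto
      qed
      then have "m \<circ> f \<in> J" using J_absorbs[OF f(1) m id_in] by simp
      then show ?thesis unfolding map_action_diff_vec using rg
        by (intro vec.span_base) blast
    qed
  qed
  then have "vec.span (map_action m ` ?G) \<subseteq> vec.span ?G"
    by (intro vec.span_minimal) auto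
  then show "map_action m v \<in> diff_span"
    using v unfolding diff_span_def map_action.span_image by blast
qed

text \<open>For f in J, the product f o m is either constant, hence zero on \<open>Aug\<close>, or
  again in J.\<close>

lemma FM_submodule_annihilator:
  "FM_submodule M {v \<in> (Aug :: ('k::field ^ 'a) set). \<forall>f\<in>J. map_action f v = 0}"
  unfolding FM_submodule_iff[OF monoid]
proof (intro conjI ballI)
  show "vec.subspace {v \<in> (Aug :: ('k ^ 'a) set). \<forall>f\<in>J. map_action f v = 0}"
    using subspace_Aug
    by (auto simp: vec.subspace_def map_action.add map_action.scale)
  fix m and v :: "'k ^ 'a"
  assume m: "m \<in> M" and v: "v \<in> {v \<in> Aug. \<forall>f\<in>J. map_action f v = 0}"
  have "map_action f (map_action m v) = 0" if f: "f \<in> J" for f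
  proof (cases "\<exists>z. f \<circ> m = (\<lambda>_. z)")
    case True
    then obtain z where "f \<circ> m = (\<lambda>_. z)" by blast
    then have "map_action (f \<circ> m) v = 0" using v by (simp only: map_action_constant mem_Collect_eq)
    then show ?thesis by (simp only: map_action_comp)
  next
    case False
    then have "f \<circ> m \<in> J" using J_absorbs[OF f id_in m] by simp
    then show ?thesis using v by (simp flip: map_action_comp)
  qed
  then show "map_action m v \<in> {v \<in> Aug. \<forall>f\<in>J. map_action f v = 0}"
    using v by (simp add: map_action_in_Aug)
qed

theorem simple_Aug_iff:
  "simple_FM_module M (Aug :: ('k::field ^ 'a) set) \<longleftrightarrow>
     diff_span = (Aug :: ('k ^ 'a) set) \<and>
     (\<forall>v\<in>(Aug :: ('k ^ 'a) set). (\<forall>f\<in>J. map_action f v = 0) \<longrightarrow> v = 0)"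
    (is "?simple \<longleftrightarrow> ?crit")
proof
  let ?D = "diff_span :: ('k ^ 'a) set"
  let ?K = "{v \<in> (Aug :: ('k ^ 'a) set). \<forall>f\<in>J. map_action f v = 0}"
  obtain e where e: "e \<in> J" "e \<circ> e = e" using regular by (auto simp: idempotents_def)
  obtain a b where ab: "range e = {a, b}" "a \<noteq> b" using range_J[OF e(1)] .
  have d: "diff_vec a b \<noteq> (0 :: 'k ^ 'a)" using ab(2) by (rule diff_vec_nonzero)
  assume S: ?simple
  have "diff_vec a b \<in> ?D"
    unfolding diff_span_def using e(1) ab(1) by (intro vec.span_base) blast
  then have "?D = Aug"
    using S FM_submodule_diff_span diff_span_subset_Aug d unfolding simple_FM_module_def by blast
  \<comment> \<open>An idempotent fixes its image pointwise, so e fixes a - b and the annihilator of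
    J is proper.\<close>
  moreover have "e a = a" "e b = b"
    using e(2) ab(1) by (metis comp_apply imageE insertCI)+
  then have "diff_vec a b \<notin> ?K"
    using d e(1) by (auto simp: map_action_diff_vec intro!: bexI[of _ e])
  then have "?K \<noteq> Aug" using diff_vec_in_Aug by metis
  then have "?K = {0}"
    using S FM_submodule_annihilator unfolding simple_FM_module_def by blast
  ultimately show ?crit by blast
next
  assume C: ?crit
  obtain e where e: "e \<in> J" using regular by (auto simp: idempotents_def)
  obtain a b where ab: "range e = {a, b}" "a \<noteq> b" using range_J[OF e] .
  have "diff_vec a b \<in> (Aug :: ('k ^ 'a) set)" "diff_vec a b \<noteq> (0 :: 'k ^ 'a)"
    using diff_vec_in_Aug diff_vec_nonzero[OF ab(2)] by blast+
  then have nontriv: "(Aug :: ('k ^ 'a) set) \<noteq> {0}" by blast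
  have "U = Aug" if U: "FM_submodule M U" "U \<subseteq> Aug" "U \<noteq> {0}" for U :: "('k ^ 'a) set"
  proof -
    have sub: "vec.subspace U" and act: "\<And>m v. m \<in> M \<Longrightarrow> v \<in> U \<Longrightarrow> map_action m v \<in> U"
      using U(1) FM_submodule_iff[OF monoid] by blast+
    obtain u where u: "u \<in> U" "u \<noteq> 0" using U(3) vec.subspace_0[OF sub] by blast
    then obtain f where f: "f \<in> J" "map_action f u \<noteq> 0" using C U(2) by blast
    obtain a b where ab: "range f = {a, b}" "a \<noteq> b" using range_J[OF f(1)] .
    obtain c where c: "map_action f u = c *s diff_vec a b"
      using map_action_rank_two[of u f a b] u(1) U(2) ab by blast
    then have "c \<noteq> 0" using f(2) by auto
    have "c *s diff_vec a b \<in> U" using act[of f u] f(1) J_subset u(1) c by auto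
    then have "inverse c *s (c *s diff_vec a b) \<in> U" by (rule vec.subspace_scale[OF sub])
    then have dU: "diff_vec a b \<in> U" using \<open>c \<noteq> 0\<close> by simp
    have "diff_vec p q \<in> U" if h: "h \<in> J" "range h = {p, q}" for h p q
    proof -
      \<comment> \<open>As h = x f y has rank 2, x maps the image of f onto that of h, possibly in
        the opposite order; this costs only a sign.\<close>
      obtain x y where xy: "x \<in> M" "h = x \<circ> f \<circ> y" using ex_J_factor[OF f(1) h(1)] by blast
      have "range h \<subseteq> x ` range f" using xy(2) by auto
      then have "{p, q} \<subseteq> {x a, x b}" using h(2) ab(1) by simp
      moreover have "p \<noteq> q" using rank_two[OF h(1)] h(2) by auto
      ultimately consider "p = x a" "q = x b" | "p = x b" "q = x a" by blast
      moreover have xU: "diff_vec (x a) (x b) \<in> U"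
        using act[OF xy(1) dU] by (simp add: map_action_diff_vec)
      moreover have "diff_vec (x b) (x a) \<in> U"
        using vec.subspace_neg[OF sub xU] by simp
      ultimately show ?thesis by cases auto
    qed
    then have "diff_span \<subseteq> U"
      unfolding diff_span_def using sub by (intro vec.span_minimal) auto
    then show ?thesis using C U(2) by blast
  qed
  moreover have "FM_submodule M (Aug :: ('k ^ 'a) set)"
    by (simp add: FM_submodule_iff[OF monoid] subspace_Aug map_action_in_Aug)
  ultimately show ?simple using nontriv unfolding simple_FM_module_def by blast
qed

section \<open>The matrix \<open>P'\<close> as a pairing of differences with block sums\<close>

text \<open>\<open>block_sums\<close> is the transposed action of the matrix whose columns are the indicator
  vectors of the blocks in \<^term>\<open>N1 \<omega> J\<close>; it maps the difference vectors to the rows of \<^term>\<open>P'\<close>.\<close>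

definition block_sums :: "(nat \<Rightarrow> 'a) \<Rightarrow> 'k::field ^ 'a \<Rightarrow> 'k ^ ('a set)" where
  "block_sums \<omega> v = (\<chi> B. if B \<in> N1 \<omega> J then \<Sum>x\<in>B. v $ x else 0)"

lemma linear_block_sums:
  "Vector_Spaces.linear (*s) (*s) (block_sums \<omega> :: 'k::field ^ 'a \<Rightarrow> _)"
  by unfold_locales
    (auto simp: vec_eq_iff block_sums_def sum.distrib sum_distrib_left algebra_simps)

text \<open>Every f in J shares its kernel with an idempotent, so its block around
  \<open>\<omega> 1\<close> belongs to \<open>N1\<close>. One block per kernel is enough, since on
  \<open>Aug\<close> the other block sum is the negative.\<close>

lemma block_sums_eq_0_iff:
  fixes v :: "'k::field ^ 'a"
  assumes v: "v \<in> Aug"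
  shows "block_sums \<omega> v = 0 \<longleftrightarrow> (\<forall>f\<in>J. map_action f v = 0)"
proof
  assume z: "block_sums \<omega> v = 0"
  show "\<forall>f\<in>J. map_action f v = 0"
  proof
    fix f assume f: "f \<in> J"
    obtain g where g: "g \<in> idempotents J" "\<And>a b. g a = g b \<longleftrightarrow> f a = f b"
      using ex_idempotent_same_kernel[OF f] by blast
    have "f -` {f (\<omega> 1)} = g -` {g (\<omega> 1)}" using g(2) by auto
    then have "f -` {f (\<omega> 1)} \<in> N1 \<omega> J" using g(1) by (auto simp: N1_def)
    moreover have "block_sums \<omega> v $ (f -` {f (\<omega> 1)}) = 0" using z by simp
    ultimately have s: "(\<Sum>x\<in>f -` {f (\<omega> 1)}. v $ x) = 0" by (simp add: block_sums_def)
    obtain a b where ab: "range f = {a, b}" "a \<noteq> b" using range_J[OF f] .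
    then have "f (\<omega> 1) = a \<or> f (\<omega> 1) = b" by blast
    then show "map_action f v = 0"
    proof
      assume "f (\<omega> 1) = a"
      then show ?thesis using map_action_rank_two[OF v ab] s by simp
    next
      assume "f (\<omega> 1) = b"
      then show ?thesis using map_action_rank_two[OF v, of f b a] ab s by (simp add: insert_commute)
    qed
  qed
next
  assume z: "\<forall>f\<in>J. map_action f v = 0"
  have "(\<Sum>x\<in>B. v $ x) = 0" if B: "B \<in> N1 \<omega> J" for B
  proof -
    obtain e where "e \<in> J" "B = e -` {e (\<omega> 1)}"
      using B unfolding N1_def idempotents_def by blast
    \<comment> \<open>The block is the fibre of e over e(\<open>\<omega> 1\<close>), so its sum is a
      coordinate of \<open>map_action e v\<close>.\<close>
    then show ?thesis using z by (metis map_action_nth zero_index)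
  qed
  then show "block_sums \<omega> v = 0" by (simp add: block_sums_def vec_eq_iff)
qed

text \<open>The three cases of \<open>P'_entry\<close> are the differences [a in B] - [b in B] of
  indicators, that is, the sums over B of the coefficients of a - b.\<close>

lemma row_P':
  "row p (P' n \<omega> J :: 'k::field ^ ('a set) ^ ('a \<times> 'a)) =
     (if p \<in> N2 n \<omega> J then block_sums \<omega> (diff_vec (fst p) (snd p)) else 0)"
  by (auto simp: vec_eq_iff row_def P'_def P'_entry_def block_sums_def sum_subtractf axis_def)

text \<open>Idempotents realise all images of maps in J, and the convention i < j merely selects one
  of a - b and b - a.\<close>

lemma diff_span_eq_N2:
  assumes \<omega>: "bij_betw \<omega> {1..n} (UNIV :: 'a set)"
  shows "(diff_span :: ('k::field ^ 'a) set) = vec.span ((\<lambda>p. diff_vec (fst p) (snd p)) ` N2 n \<omega> J)"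
    (is "_ = vec.span ?S")
proof
  have "diff_vec a b \<in> vec.span ?S" if f: "f \<in> J" "range f = {a, b}" for a b f
  proof -
    obtain g where g: "g \<in> idempotents J" "range g = {a, b}"
      using ex_idempotent_same_range[OF f(1)] f(2) by auto
    obtain i j where ij: "i \<in> {1..n}" "j \<in> {1..n}" "a = \<omega> i" "b = \<omega> j"
      using bij_betw_imp_surj_on[OF \<omega>] by (metis UNIV_I imageE)
    have "i \<noteq> j" using rank_two[OF f(1)] f(2) ij by auto
    then consider "i < j" | "j < i" by linarith
    then show ?thesis
    proof cases
      case 1
      then have "(a, b) \<in> N2 n \<omega> J" using g ij unfolding N2_def by blast
      then show ?thesis by (intro vec.span_base) force
    next
      case 2
      then have "(b, a) \<in> N2 n \<omega> J" using g ij unfolding N2_def insert_commute[of a b] by blast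
      then have "diff_vec b a \<in> vec.span ?S" by (intro vec.span_base) force
      then have "- diff_vec b a \<in> vec.span ?S" by (rule vec.span_neg)
      then show ?thesis by simp
    qed
  qed
  then show "diff_span \<subseteq> vec.span ?S"
    unfolding diff_span_def by (intro vec.span_minimal) auto
  have "\<exists>f\<in>J. range f = {fst p, snd p}" if p: "p \<in> N2 n \<omega> J" for p
  proof -
    obtain i j e where "p = (\<omega> i, \<omega> j)" "e \<in> idempotents J" "range e = {\<omega> i, \<omega> j}"
      using p unfolding N2_def by blast
    then show ?thesis by (intro bexI[of _ e]) (simp_all add: idempotents_def)
  qed
  then show "vec.span ?S \<subseteq> diff_span"
    unfolding diff_span_def by (intro vec.span_mono) blast
qed

text \<open>The row space is the image under \<open>block_sums\<close> of the span of the
  differences indexed by \<open>N2\<close>; the bordering rows contribute only the zero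
  vector.\<close>

lemma rank_P':
  assumes "bij_betw \<omega> {1..n} (UNIV :: 'a set)"
  shows "rank (P' n \<omega> J :: 'k::field ^ ('a set) ^ ('a \<times> 'a))
    = vec.dim (block_sums \<omega> ` (diff_span :: ('k ^ 'a) set))"
proof -
  interpret T: Vector_Spaces.linear "(*s)" "(*s)" "block_sums \<omega> :: 'k ^ 'a \<Rightarrow> _"
    by (rule linear_block_sums)
  let ?d = "\<lambda>p. diff_vec (fst p) (snd p) :: 'k ^ 'a"
  let ?R = "block_sums \<omega> ` ?d ` N2 n \<omega> J"
  let ?P = "P' n \<omega> J :: 'k ^ ('a set) ^ ('a \<times> 'a)"
  have "row p ?P \<in> insert 0 ?R" for p by (simp add: row_P')
  then have "rows ?P \<subseteq> insert 0 ?R" unfolding rows_def by blast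
  moreover have "block_sums \<omega> (?d p) \<in> rows ?P" if "p \<in> N2 n \<omega> J" for p
  proof -
    have "block_sums \<omega> (?d p) = row p ?P" using that by (simp add: row_P')
    then show ?thesis unfolding rows_def by blast
  qed
  then have "?R \<subseteq> rows ?P" by blast
  ultimately have "vec.span (rows ?P) = vec.span ?R"
    using vec.span_mono[of "rows ?P" "insert 0 ?R"] vec.span_mono[of ?R "rows ?P"] by simp
  also have "\<dots> = block_sums \<omega> ` diff_span"
    by (simp only: diff_span_eq_N2[OF assms] T.span_image)
  finally show ?thesis
    unfolding row_rank_def_gen by (metis vec.dim_span)
qed

theorem simple_Aug_iff_rank_P':
  assumes "bij_betw \<omega> {1..n} (UNIV :: 'a set)"
  shows "simple_FM_module M (Aug :: ('k::field ^ 'a) set) \<longleftrightarrow>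
         rank (P' n \<omega> J :: 'k ^ ('a set) ^ ('a \<times> 'a)) = n - 1"
proof -
  have n: "CARD('a) = n" using bij_betw_same_card[OF assms] by simp
  have "rank (P' n \<omega> J :: 'k ^ ('a set) ^ ('a \<times> 'a)) = n - 1 \<longleftrightarrow>
      vec.dim (block_sums \<omega> ` (diff_span :: ('k ^ 'a) set)) = vec.dim (Aug :: ('k ^ 'a) set)"
    by (simp add: rank_P'[OF assms] dim_Aug n)
  also have "\<dots> \<longleftrightarrow> diff_span = (Aug :: ('k ^ 'a) set) \<and>
      (\<forall>v\<in>(Aug :: ('k ^ 'a) set). block_sums \<omega> v = 0 \<longrightarrow> v = 0)"
    by (intro dim_linear_image_eq_iff linear_block_sums subspace_Aug diff_span_subset_Aug)
      (simp add: diff_span_def)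
  also have "\<dots> \<longleftrightarrow> simple_FM_module M (Aug :: ('k ^ 'a) set)"
    unfolding simple_Aug_iff using block_sums_eq_0_iff by blast
  finally show ?thesis by blast
qed

end

theorem theorem3p3:
  fixes n :: nat
    and \<omega> :: "nat \<Rightarrow> 'a::finite"
    and M J :: "('a \<Rightarrow> 'a) set"
  assumes "n > 1"
    and "bij_betw \<omega> {1..n} (UNIV :: 'a set)"
    and "transformation_monoid M"
    and "\<exists>m\<in>minimal_ideal M. \<exists>x. m = (\<lambda>_. x)"
    and "unique_minimal_J_class_in M (M - minimal_ideal M) J"
    and "regular_J_class J"
    and "\<forall>m\<in>J. map_rank m = 2"
  shows "simple_FM_module M (Aug :: ('k::field ^ 'a) set) \<longleftrightarrow>
         rank (P' n \<omega> J :: 'k ^ ('a set) ^ ('a \<times> 'a)) = n - 1"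
proof -
  note mon = assms(3)
  note I_eq = minimal_ideal_eq_constants[OF mon assms(4)]
  have minJ: "minimal_J_class_in M (M - minimal_ideal M) J"
    using assms(5) by (simp add: unique_minimal_J_class_in_def)
  then have JM: "J \<subseteq> M" by (auto simp: minimal_J_class_in_def)
  \<comment> \<open>The minimal ideal consists of the constants in M, so nonconstant elements of M
    lie outside it.\<close>
  have below: "f \<in> principal_ideal M m" if "m \<in> M" "\<forall>x. m \<noteq> (\<lambda>_. x)" "f \<in> J" for m f
    using that I_eq
    by (intro unique_minimal_J_class_below[OF mon minimal_ideal_properties(1)[OF mon] assms(5)]) auto
  have "rank_two_class M J"
  proof
    show "transformation_monoid M" "J \<subseteq> M" by fact+
    show "card (range f) = 2" if "f \<in> J" for f
      using that assms(7) by (simp add: map_rank_def)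
    show "\<exists>x\<in>M. \<exists>y\<in>M. f = x \<circ> m \<circ> y" if "m \<in> M" "\<forall>x. m \<noteq> (\<lambda>_. x)" "f \<in> J" for m f
      using below[OF that] by (auto simp: principal_ideal_def)
    show "x \<circ> f \<circ> y \<in> J" if "f \<in> J" "x \<in> M" "y \<in> M" "\<forall>z. x \<circ> f \<circ> y \<noteq> (\<lambda>_. z)" for f x y
    proof -
      have m: "x \<circ> f \<circ> y \<in> M" "x \<circ> f \<circ> y \<in> principal_ideal M f"
        using that JM mon by (auto simp: transformation_monoid_def principal_ideal_def)
      \<comment> \<open>The product lies below f, and f lies below the product because the latter is
        nonconstant; so the two are \<J>-equivalent.\<close>
      have "f \<in> principal_ideal M (x \<circ> f \<circ> y)" using below[OF m(1) that(4,1)] .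
      then have "principal_ideal M f = principal_ideal M (x \<circ> f \<circ> y)"
        using m(2) by (intro subset_antisym principal_ideal_subset[OF mon])
      moreover obtain c where "J = J_class M c"
        using minJ by (auto simp: minimal_J_class_in_def J_classes_def)
      ultimately show ?thesis using that(1) m(1) by (simp add: J_class_def)
    qed
    show "idempotents J \<noteq> {}" using assms(6) by (simp add: regular_J_class_def)
  qed
  then show ?thesis by (rule rank_two_class.simple_Aug_iff_rank_P'[OF _ assms(2)])
qed

end
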